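(* Let $G$ be a simple, undirected, non-regular graph on $N$ nodes with non-negative link weights, maximum weighted degree $d_{\max}$, spectral radius $\lambda_1$ and spectral degree exponent $q$. Let $c$ be the multiplicity of $d_{\max}$ (the number of nodes of weighted degree $d_{\max}$), and let $d_{2}$ be the second-largest weighted degree, i.e. the largest weighted degree strictly smaller than $d_{\max}$. Then $$\frac{\log N-\log\left(c+(N-c)\left(\frac{d_{2}}{d_{\max}}\right)^{2}\right)}{\log\left(\frac{d_{\max}}{\lambda_1}\right)}\;\le\; q\;\le\;\frac{\log\frac{N}{c}}{\log\left(\frac{d_{\max}}{\lambda_1}\right)}.$$
   Context: $G$ is a finite simple undirected graph (possibly disconnected) represented by its weighted adjacency matrix $A=(a_{ij})$, a real symmetric $N\times N$ matrix with non-negative entries and zero diagonal. The weighted degree of node $i$ is $d_i=\sum_{j=1}^N a_{ij}$ (in the claim, the symbol $d_2$ is reserved for the second-largest weighted degree value), and $G$ is non-regular if not all weighted degrees are equal. The spectral radius $\lambda_1$ is the largest eigenvalue of $A$. Spectral degree exponent (SDE): for non-regular $G$, the SDE is the solution $q$ of $$\lambda_1=\left(\frac1N\sum_{i=1}^N d_i^{\,q}\right)^{1/q}.$$ It is a known fact that this solution exists, is unique and lies in $[2,\infty]$. For $q=\infty$ the right-hand side is understood as its limit $d_{\max}$, i.e. $q=\infty$ means $\lambda_1=d_{\max}$. In that case the denominators in the claim vanish while the numerators are positive, and both bounds are read as $+\infty$. *)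

theory Defs
  imports "Jordan_Normal_Form.Spectral_Radius" "HOL-Library.Extended_Real"
begin

definition weighted_adjacency :: "nat \<Rightarrow> real mat \<Rightarrow> bool" where
  "weighted_adjacency N A \<longleftrightarrow>
     A \<in> carrier_mat N N \<and>
     transpose_mat A = A \<and>
     (\<forall>i<N. \<forall>j<N. 0 \<le> A $$ (i, j)) \<and>
     (\<forall>i<N. A $$ (i, i) = 0)"

definition wdegree :: "real mat \<Rightarrow> nat \<Rightarrow> real" where
  "wdegree A i = (\<Sum>j<dim_col A. A $$ (i, j))"

definition degree_values :: "real mat \<Rightarrow> real set" where
  "degree_values A = wdegree A ` {..<dim_row A}"

definition regular :: "real mat \<Rightarrow> bool" where
  "regular A \<longleftrightarrow> (\<forall>i<dim_row A. \<forall>j<dim_row A. wdegree A i = wdegree A j)"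

definition max_degree :: "real mat \<Rightarrow> real" where
  "max_degree A = Max (degree_values A)"

definition max_degree_mult :: "real mat \<Rightarrow> nat" where
  "max_degree_mult A = card {i. i < dim_row A \<and> wdegree A i = max_degree A}"

text \<open>The maximum below ranges over a nonempty set exactly for non-regular graphs.\<close>

definition second_degree :: "real mat \<Rightarrow> real" where
  "second_degree A = Max {x \<in> degree_values A. x < max_degree A}"

text \<open>The set \<open>spectrum A\<close> consists of the real eigenvalues of \<open>A\<close>; for symmetric \<open>A\<close> these are all
  eigenvalues. For an adjacency matrix, the largest of them is the spectral radius. The constant
  \<open>spectral_radius\<close> of the imported theory is defined for complex matrices only.\<close>

definition lambda1 :: "real mat \<Rightarrow> real" where
  "lambda1 A = Max (spectrum A)"

text \<open>\<open>is_sde A q\<close> states that \<open>q\<close> solves the defining equation of the spectral degree exponent.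
  A finite exponent is admitted whenever the right-hand side makes sense: it must be nonzero, and
  it may be negative only if no degree vanishes (the side condition is needed because
  \<open>0 powr r = 0\<close> also for negative \<open>r\<close>). The exponent \<open>\<infinity>\<close> stands for the limit of the
  power means, which is the maximum degree.\<close>

definition is_sde :: "real mat \<Rightarrow> ereal \<Rightarrow> bool" where
  "is_sde A q \<longleftrightarrow>
     (case q of
        ereal r \<Rightarrow>
          r \<noteq> 0 \<and> (r < 0 \<longrightarrow> (\<forall>i<dim_row A. 0 < wdegree A i)) \<and>
          lambda1 A =
            (1 / real (dim_row A) * (\<Sum>i<dim_row A. wdegree A i powr r)) powr (1 / r)
      | PInfty \<Rightarrow> lambda1 A = max_degree A
      | MInfty \<Rightarrow> False)"

text \<open>When \<open>lambda1 A = max_degree A\<close>, the bounds have denominator \<open>ln 1 = 0\<close> and positive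
  numerators; division in \<open>ereal\<close> then yields \<open>\<infinity>\<close>, as intended.\<close>

lemma ereal_pos_divide_zero: "0 < x \<Longrightarrow> ereal x / ereal 0 = \<infinity>"
  by (simp add: divide_ereal_def)

end

(* Put s = \<Sum>i. (d_i / d_max)^q. The defining equation of the exponent reads
   q * log (d_max / lambda_1) = log N - log s. The c nodes of maximum degree contribute c to s;
   if q \<ge> 2, every other node contributes at most (d_2 / d_max)^2. This gives both bounds.
   That q \<ge> 2 follows from strict monotonicity of power means, because lambda_1 is at least the
   quadratic mean of the degrees. To see the latter, maximise |A x|^2 over the unit sphere. As A has
   non-negative entries, the maximiser x may be taken non-negative; then A^2 x = mu^2 x, where
   mu^2 is the maximum, and A x + mu x is an eigenvector of A for mu. Comparing with the all-ones
   vector bounds mu from below. *)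

theory Submission
  imports Defs "HOL-Analysis.Function_Topology"
begin

section \<open>Strict monotonicity of power means\<close>

text \<open>Strict concavity of \<open>x powr a\<close> at 1, for exponents between 0 and 1. With
  \<open>x = exp t\<close>, the inequality \<open>1 + u < exp u\<close> is used at
  \<open>u = - a * t\<close> and at \<open>u = (1 - a) * t\<close>; weighted by \<open>1 - a\<close>
  and \<open>a\<close>, the terms linear in \<open>t\<close> cancel.\<close>

lemma powr_less_tangent:
  fixes x a :: real
  assumes "0 \<le> x" "x \<noteq> 1" "0 < a" "a < 1"
  shows "x powr a < 1 + a * (x - 1)"
proof (cases "x = 0")
  case True
  then show ?thesis using assms by simp
next
  case False
  define t where "t = ln x"
  have x: "x = exp t" and t: "t \<noteq> 0"
    using False assms by (auto simp: t_def)
  have strict: "1 + u < exp u" if "u \<noteq> 0" for u :: real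
    using that by (smt (verit) exp_ge_add_one_self exp_gt_zero ln_eq_minus_one ln_exp)
  have "exp (a * t) * (1 + (- a * t)) < exp (a * t) * exp (- a * t)"
    using strict[of "- a * t"] t assms by simp
  then have 1: "exp (a * t) * (1 - a * t) < 1"
    by (simp flip: exp_add)
  have "exp (a * t) * (1 + (1 - a) * t) < exp (a * t) * exp ((1 - a) * t)"
    using strict[of "(1 - a) * t"] t assms by simp
  also have "\<dots> = x"
    by (simp add: x algebra_simps flip: exp_add)
  finally have 2: "exp (a * t) * (1 + (1 - a) * t) < x" .
  have "exp (a * t) = (1 - a) * (exp (a * t) * (1 - a * t)) + a * (exp (a * t) * (1 + (1 - a) * t))"
    by (simp add: algebra_simps)
  also have "\<dots> < (1 - a) * 1 + a * x"
    by (intro add_strict_mono mult_strict_left_mono 1 2) (use assms in auto)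
  finally show ?thesis
    by (simp add: x powr_def algebra_simps)
qed

text \<open>The convex counterpart for negative exponents: \<open>exp\<close> lies above its tangent
  at 0, and multiplying \<open>ln x < x - 1\<close> by \<open>a\<close> reverses it. At
  \<open>x = 0\<close> the inequality would fail, because \<open>0 powr a = 0\<close>.\<close>

lemma powr_greater_tangent:
  fixes x a :: real
  assumes "0 < x" "x \<noteq> 1" "a < 0"
  shows "1 + a * (x - 1) < x powr a"
proof -
  have "1 + a * ln x \<le> x powr a"
    using exp_ge_add_one_self[of "a * ln x"] assms by (simp add: powr_def)
  moreover have "ln x < x - 1"
    using assms ln_eq_minus_one[of x] ln_le_minus_one[of x] by linarith
  then have "a * (x - 1) < a * ln x"
    using assms by simp
  ultimately show ?thesis by linarith
qed

text \<open>Dividing the powers \<open>d i powr s\<close> by their mean \<open>M\<close> gives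
  numbers \<open>x i\<close> of mean 1, and the claim compares the mean of \<open>x i powr a\<close>
  with 1, where \<open>a = r / s < 1\<close>. Summing the tangent inequality at 1 does this; the
  sign of \<open>r\<close> decides between the concave and the convex case.\<close>

lemma power_mean_strict_mono:
  fixes d :: "'i \<Rightarrow> real"
  assumes fin: "finite I" and nonneg: "\<And>i. i \<in> I \<Longrightarrow> 0 \<le> d i"
    and differ: "j \<in> I" "k \<in> I" "d j \<noteq> d k"
    and r: "r \<noteq> 0" "r < 0 \<Longrightarrow> (\<And>i. i \<in> I \<Longrightarrow> 0 < d i)" and s: "r < s" "0 < s"
  shows "((\<Sum>i\<in>I. d i powr r) / card I) powr (1 / r) < ((\<Sum>i\<in>I. d i powr s) / card I) powr (1 / s)"
proof -
  define M where "M = (\<Sum>i\<in>I. d i powr s) / card I"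
  define a where "a = r / s"
  define x where "x i = d i powr s / M" for i
  have card: "0 < card I"
    using fin differ card_gt_0_iff by blast
  have "0 < d j \<or> 0 < d k"
    using nonneg[OF differ(1)] nonneg[OF differ(2)] differ(3) by linarith
  then obtain l where "l \<in> I" "0 < d l"
    using differ by blast
  then have "0 < (\<Sum>i\<in>I. d i powr s)"
    using fin by (intro sum_pos2[of _ l]) auto
  then have M: "0 < M"
    using card by (simp add: M_def)
  \<comment> \<open>Since the \<open>x i\<close> have mean 1, the linear terms of the tangents add
    up to 0.\<close>
  have sum_x: "(\<Sum>i\<in>I. 1 + a * (x i - 1)) = card I"
  proof -
    have "(\<Sum>i\<in>I. x i) = (\<Sum>i\<in>I. d i powr s) / M"
      by (simp add: x_def sum_divide_distrib)
    also have "\<dots> = card I"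
      using M by (auto simp: M_def)
    finally have "(\<Sum>i\<in>I. x i) = card I" .
    then show ?thesis
      by (simp add: sum.distrib sum_subtractf flip: sum_distrib_left)
  qed
  \<comment> \<open>Two different values cannot both be 1, so the tangent inequality is strict for
    at least one index.\<close>
  have "x j \<noteq> x k"
  proof
    assume "x j = x k"
    then have "(d j powr s) powr (1 / s) = (d k powr s) powr (1 / s)"
      using M by (simp add: x_def)
    then show False
      using differ nonneg s by (simp add: powr_powr)
  qed
  then obtain l where l: "l \<in> I" "x l \<noteq> 1"
    using differ by metis
  have x_nonneg: "0 \<le> x i" for i
    using M by (simp add: x_def)
  have a_mean: "(\<Sum>i\<in>I. x i powr a) / card I = (\<Sum>i\<in>I. d i powr r) / card I / M powr a"
    using M s by (simp add: x_def powr_divide powr_powr a_def sum_divide_distrib mult.commute)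
  have Ma: "0 < M powr a"
    using M by simp
  have M_root: "(M powr a) powr (1 / r) = M powr (1 / s)"
    using r by (simp add: powr_powr a_def)
  show ?thesis
  proof (cases "0 < r")
    case True
    then have a: "0 < a" "a < 1"
      using s by (auto simp: a_def)
    have "(\<Sum>i\<in>I. x i powr a) < (\<Sum>i\<in>I. 1 + a * (x i - 1))"
    proof (rule sum_strict_mono_ex1[OF fin])
      show "\<forall>i\<in>I. x i powr a \<le> 1 + a * (x i - 1)"
        using powr_less_tangent[OF x_nonneg _ a]
        by (metis less_eq_real_def diff_self mult_zero_right add_0_right
            powr_one_eq_one)
      show "\<exists>i\<in>I. x i powr a < 1 + a * (x i - 1)"
        using powr_less_tangent[OF x_nonneg _ a] l by blast
    qed
    then have "(\<Sum>i\<in>I. x i powr a) / card I < 1"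
      using card sum_x by simp
    then have "(\<Sum>i\<in>I. d i powr r) / card I < M powr a"
      unfolding a_mean divide_less_eq_1_pos[OF Ma] .
    then have "((\<Sum>i\<in>I. d i powr r) / card I) powr (1 / r) < (M powr a) powr (1 / r)"
      using True by (intro powr_less_mono2) (auto intro!: divide_nonneg_nonneg sum_nonneg)
    then show ?thesis
      unfolding M_root by (simp add: M_def)
  next
    case False
    then have neg: "r < 0"
      using r by simp
    then have a: "a < 0"
      using s by (simp add: a_def divide_neg_pos)
    have x_pos: "0 < x i" if "i \<in> I" for i
      using r(2)[OF neg that] M by (simp add: x_def)
    have "(\<Sum>i\<in>I. 1 + a * (x i - 1)) < (\<Sum>i\<in>I. x i powr a)"
    proof (rule sum_strict_mono_ex1[OF fin])
      show "\<forall>i\<in>I. 1 + a * (x i - 1) \<le> x i powr a"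
        using powr_greater_tangent[OF x_pos _ a]
        by (metis less_eq_real_def diff_self mult_zero_right add_0_right
            powr_one_eq_one)
      show "\<exists>i\<in>I. 1 + a * (x i - 1) < x i powr a"
        using powr_greater_tangent[OF x_pos _ a] l by blast
    qed
    then have "1 < (\<Sum>i\<in>I. x i powr a) / card I"
      using card sum_x by simp
    then have "M powr a < (\<Sum>i\<in>I. d i powr r) / card I"
      unfolding a_mean less_divide_eq_1_pos[OF Ma] .
    \<comment> \<open>The negative exponent \<open>1 / r\<close> reverses the inequality, so the
      direction agrees with the case of positive \<open>r\<close>.\<close>
    then have "((\<Sum>i\<in>I. d i powr r) / card I) powr (1 / r) < (M powr a) powr (1 / r)"
      using neg M by (intro powr_less_mono2_neg) auto
    then show ?thesis
      unfolding M_root by (simp add: M_def)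
  qed
qed

section \<open>Maximisers of quadratic forms on the unit sphere\<close>

lemma scalar_prod_self_eq_0_iff:
  fixes x :: "real vec"
  assumes "x \<in> carrier_vec n"
  shows "x \<bullet> x = 0 \<longleftrightarrow> x = 0\<^sub>v n"
proof -
  have "x \<bullet> x = 0 \<longleftrightarrow> (\<forall>i<n. x $ i = 0)"
    using assms by (auto simp: scalar_prod_def sum_nonneg_eq_0_iff)
  then show ?thesis
    using assms by (auto intro!: eq_vecI)
qed

lemma quadratic_form_sum:
  assumes "B \<in> carrier_mat n n" "x \<in> carrier_vec n"
  shows "x \<bullet> (B *\<^sub>v x) = (\<Sum>i<n. \<Sum>j<n. x $ i * (B $$ (i, j) * x $ j))"
  using assms by (simp add: scalar_prod_def lessThan_atLeast0 sum_distrib_left)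

text \<open>Compactness of the sphere, with vectors modelled by functions on \<open>nat\<close>
  under the product topology. The cube \<open>C\<close> is compact as a product of intervals,
  \<open>S\<close> is closed, and \<open>F\<close> is continuous; both \<open>S\<close> and
  \<open>F\<close> depend on the first \<open>n\<close> coordinates only. Homogeneity carries the
  bound from the sphere to all vectors.\<close>

lemma rayleigh_maximiser_exists:
  fixes B :: "real mat"
  assumes B: "B \<in> carrier_mat n n" and n: "0 < n"
  obtains x where "x \<in> carrier_vec n" "x \<bullet> x = 1"
    "\<And>y. y \<in> carrier_vec n \<Longrightarrow> y \<bullet> (B *\<^sub>v y) \<le> x \<bullet> (B *\<^sub>v x) * (y \<bullet> y)"
proof -
  define C where "C = (UNIV :: nat set) \<rightarrow>\<^sub>E {-1..1::real}"
  define S where "S = {f :: nat \<Rightarrow> real. (\<Sum>i<n. f i * f i) = 1}"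
  define F where "F f = (\<Sum>i<n. \<Sum>j<n. f i * (B $$ (i, j) * f j))" for f :: "nat \<Rightarrow> real"
  have F_eq: "F f = vec n f \<bullet> (B *\<^sub>v vec n f)" for f
    by (simp add: F_def quadratic_form_sum[OF B])
  have norm_eq: "vec n f \<bullet> vec n f = (\<Sum>i<n. f i * f i)" for f :: "nat \<Rightarrow> real"
    by (simp add: scalar_prod_def lessThan_atLeast0)
  have "compactin (product_topology (\<lambda>_. euclidean) UNIV) C"
    unfolding C_def compactin_PiE by simp
  then have "compact C"
    by (simp add: euclidean_product_topology)
  moreover have "closed S"
    unfolding S_def by (intro closed_Collect_eq continuous_intros continuous_on_product_coordinates)
  ultimately have "compact (C \<inter> S)"
    by (rule compact_Int_closed)
  \<comment> \<open>The first unit vector shows that the set is nonempty; this is where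
    \<open>0 < n\<close> enters.\<close>
  moreover have "(\<lambda>i. if i = 0 then 1 else 0) \<in> C \<inter> S"
    using n by (auto simp: C_def S_def if_distrib cong: if_cong)
  moreover have "continuous_on UNIV F"
    unfolding F_def by (intro continuous_intros continuous_on_product_coordinates)
  then have "continuous_on (C \<inter> S) F"
    by (rule continuous_on_subset) simp
  ultimately obtain f where f: "f \<in> S" and max: "\<And>g. g \<in> C \<inter> S \<Longrightarrow> F g \<le> F f"
    using continuous_attains_sup[of "C \<inter> S" F] by (metis IntD2 empty_iff)
  show ?thesis
  proof
    show "vec n f \<in> carrier_vec n" "vec n f \<bullet> vec n f = 1"
      using f by (auto simp: norm_eq S_def)
    fix y :: "real vec"
    assume y: "y \<in> carrier_vec n"
    show "y \<bullet> (B *\<^sub>v y) \<le> vec n f \<bullet> (B *\<^sub>v vec n f) * (y \<bullet> y)"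
    proof (cases "y \<bullet> y = 0")
      case True
      then have "y = 0\<^sub>v n"
        using y scalar_prod_self_eq_0_iff by blast
      then show ?thesis
        using B by simp
    next
      case False
      \<comment> \<open>The vector \<open>y\<close> is scaled to norm 1; padding with zeros beyond
        \<open>n\<close> keeps \<open>g\<close> inside the cube.\<close>
      define m where "m = sqrt (y \<bullet> y)"
      define g where "g i = (if i < n then y $ i / m else 0)" for i
      have yy: "y \<bullet> y = (\<Sum>i<n. y $ i * y $ i)"
        using y by (simp add: scalar_prod_def lessThan_atLeast0)
      then have "0 \<le> y \<bullet> y"
        by (simp add: sum_nonneg)
      then have m: "0 < m" and mm: "m * m = y \<bullet> y"
        using False by (auto simp: m_def)
      have "(\<Sum>i<n. g i * g i) = 1"
      proof -
        have "(\<Sum>i<n. g i * g i) = (\<Sum>i<n. y $ i * y $ i) / (m * m)"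
          by (simp add: g_def sum_divide_distrib)
        then show ?thesis
          using False by (simp add: mm flip: yy)
      qed
      then have gS: "g \<in> S"
        by (simp add: S_def)
      have "\<bar>y $ i\<bar> \<le> m" if "i < n" for i
      proof -
        have "y $ i * y $ i \<le> y \<bullet> y"
          unfolding yy using that by (intro member_le_sum) auto
        then show ?thesis
          unfolding m_def by (intro real_le_rsqrt) (simp add: power2_eq_square)
      qed
      then have "\<bar>g i\<bar> \<le> 1" for i
        using m by (simp add: g_def)
      then have "g \<in> C"
        by (auto simp: C_def abs_le_iff minus_le_iff)
      then have "F g \<le> F f"
        using gS max by blast
      moreover have "F g = y \<bullet> (B *\<^sub>v y) / (m * m)"
        by (simp add: F_def quadratic_form_sum[OF B y] g_def sum_divide_distrib)
      ultimately show ?thesis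
        using False \<open>0 \<le> y \<bullet> y\<close> mm by (simp add: F_eq divide_le_eq split: if_splits)
    qed
  qed
qed

text \<open>The polynomial vanishes at 0 and so has its minimum there; hence its derivative
  \<open>2 * b\<close> at 0 is 0.\<close>

lemma nonneg_quadratic_linear_coeff_0:
  fixes b g :: real
  assumes "\<And>t. 0 \<le> 2 * t * b + t\<^sup>2 * g"
  shows "b = 0"
proof (rule ccontr)
  assume b: "b \<noteq> 0"
  define k where "k = \<bar>g\<bar> + 1"
  have k: "0 < k" "g \<le> k"
    by (auto simp: k_def)
  \<comment> \<open>This is the minimiser of \<open>2 * t * b + t\<^sup>2 * k\<close>, whose leading
    coefficient \<open>k\<close> is positive and at least \<open>g\<close>.\<close>
  define t where "t = - b / k"
  have "2 * t * b + t\<^sup>2 * g \<le> 2 * t * b + t\<^sup>2 * k"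
    using k by (intro add_left_mono mult_left_mono) auto
  also have "\<dots> = - (b\<^sup>2 / k)"
    using k by (simp add: t_def field_simps power2_eq_square)
  also have "\<dots> < 0"
    using b k by simp
  finally show False
    using assms[of t] by simp
qed

text \<open>First variation: the form
  \<open>m * (y \<bullet> y) - y \<bullet> (B *\<^sub>v y)\<close> is non-negative and vanishes at
  \<open>x\<close>. Moving from \<open>x\<close> in the direction of the defect \<open>z\<close>
  itself makes the linear coefficient equal to \<open>z \<bullet> z\<close>, which must therefore be
  0.\<close>

lemma rayleigh_maximiser_eigen:
  fixes B :: "real mat"
  assumes B: "B \<in> carrier_mat n n" and sym: "transpose_mat B = B"
    and x: "x \<in> carrier_vec n"
    and max: "\<And>y. y \<in> carrier_vec n \<Longrightarrow> y \<bullet> (B *\<^sub>v y) \<le> m * (y \<bullet> y)"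
    and eq: "x \<bullet> (B *\<^sub>v x) = m * (x \<bullet> x)"
  shows "B *\<^sub>v x = m \<cdot>\<^sub>v x"
proof -
  define z where "z = m \<cdot>\<^sub>v x - B *\<^sub>v x"
  have z: "z \<in> carrier_vec n"
    using B x by (auto simp: z_def)
  note carr = B x z mult_mat_vec_carrier[OF B]
  \<comment> \<open>Symmetry of \<open>B\<close> lets the two cross terms in the expansion of the
    form be merged.\<close>
  have swap: "u \<bullet> (B *\<^sub>v v) = v \<bullet> (B *\<^sub>v u)" if "u \<in> carrier_vec n" "v \<in> carrier_vec n" for u v
    using transpose_vec_mult_scalar[OF B that(2) that(1)] that B sym
    by (metis comm_scalar_prod mult_mat_vec_carrier)
  have "0 \<le> 2 * t * (z \<bullet> z) + t\<^sup>2 * (m * (z \<bullet> z) - z \<bullet> (B *\<^sub>v z))" for t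
  proof -
    have tz: "t \<cdot>\<^sub>v z \<in> carrier_vec n" using z by simp
    have norm: "(x + t \<cdot>\<^sub>v z) \<bullet> (x + t \<cdot>\<^sub>v z) = x \<bullet> x + 2 * t * (x \<bullet> z) + t\<^sup>2 * (z \<bullet> z)"
      using carr tz comm_scalar_prod[OF z x]
      by (simp add: add_scalar_prod_distrib[of _ n] scalar_prod_add_distrib[of _ n] power2_eq_square algebra_simps)
    have form: "(x + t \<cdot>\<^sub>v z) \<bullet> (B *\<^sub>v (x + t \<cdot>\<^sub>v z)) =
        x \<bullet> (B *\<^sub>v x) + 2 * t * (z \<bullet> (B *\<^sub>v x)) + t\<^sup>2 * (z \<bullet> (B *\<^sub>v z))"
      using carr tz swap[OF x z]
      by (simp add: mult_add_distrib_mat_vec[of _ n n] mult_mat_vec[of _ n n]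
          add_scalar_prod_distrib[of _ n] scalar_prod_add_distrib[of _ n] power2_eq_square algebra_simps)
    have zz: "z \<bullet> z = m * (x \<bullet> z) - z \<bullet> (B *\<^sub>v x)"
    proof -
      have "z \<bullet> z = z \<bullet> (m \<cdot>\<^sub>v x - B *\<^sub>v x)"
        by (simp add: z_def)
      also have "\<dots> = m * (x \<bullet> z) - z \<bullet> (B *\<^sub>v x)"
        using carr comm_scalar_prod[OF z x] by (simp add: scalar_prod_minus_distrib[of _ n])
      finally show ?thesis .
    qed
    have "0 \<le> m * ((x + t \<cdot>\<^sub>v z) \<bullet> (x + t \<cdot>\<^sub>v z)) - (x + t \<cdot>\<^sub>v z) \<bullet> (B *\<^sub>v (x + t \<cdot>\<^sub>v z))"
      using max[of "x + t \<cdot>\<^sub>v z"] x tz by simp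
    also have "\<dots> = 2 * t * (m * (x \<bullet> z) - z \<bullet> (B *\<^sub>v x)) + t\<^sup>2 * (m * (z \<bullet> z) - z \<bullet> (B *\<^sub>v z))"
      unfolding norm form eq by (simp add: algebra_simps)
    finally show ?thesis
      by (simp add: zz)
  qed
  then have "z \<bullet> z = 0"
    by (rule nonneg_quadratic_linear_coeff_0)
  then have "m \<cdot>\<^sub>v x - B *\<^sub>v x = 0\<^sub>v n"
    using z scalar_prod_self_eq_0_iff unfolding z_def by blast
  then show ?thesis
    using B x by (intro eq_vecI) (auto simp: vec_eq_iff)
qed


section \<open>The largest eigenvalue and the quadratic mean of the degrees\<close>

text \<open>The form of \<open>A * A\<close> at \<open>y\<close> is the squared norm of
  \<open>A *\<^sub>v y\<close>, so its maximum has a real square root \<mu>. From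
  \<open>(A - \<mu>)(A + \<mu>) x = 0\<close> the vector \<open>(A + \<mu>) x\<close> is an
  eigenvector for \<mu> unless it vanishes, and non-negativity of \<open>x\<close> and
  \<open>A\<close> excludes that when \<mu> is positive.\<close>

lemma nonneg_symmetric_top_eigenvalue:
  fixes A :: "real mat"
  assumes A: "A \<in> carrier_mat n n" and sym: "transpose_mat A = A" and n: "0 < n"
    and nonneg: "\<And>i j. i < n \<Longrightarrow> j < n \<Longrightarrow> 0 \<le> A $$ (i, j)"
  obtains \<mu> where "eigenvalue A \<mu>" "0 \<le> \<mu>"
    "\<forall>y\<in>carrier_vec n. (A *\<^sub>v y) \<bullet> (A *\<^sub>v y) \<le> \<mu>\<^sup>2 * (y \<bullet> y)"
proof -
  define B where "B = A * A"
  have B: "B \<in> carrier_mat n n" and B_sym: "transpose_mat B = B"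
    using A sym by (auto simp: B_def transpose_mult[OF A A])
  have B_nonneg: "0 \<le> B $$ (i, j)" if "i < n" "j < n" for i j
    using that A nonneg by (auto simp: B_def scalar_prod_def intro!: sum_nonneg)
  have form: "y \<bullet> (B *\<^sub>v y) = (A *\<^sub>v y) \<bullet> (A *\<^sub>v y)" if y: "y \<in> carrier_vec n" for y
  proof -
    have Ay: "A *\<^sub>v y \<in> carrier_vec n"
      using A y by simp
    have "y \<bullet> (B *\<^sub>v y) = (A *\<^sub>v (A *\<^sub>v y)) \<bullet> y"
      using A y Ay comm_scalar_prod[OF y, of "A *\<^sub>v (A *\<^sub>v y)"] by (simp add: B_def)
    also have "\<dots> = (A *\<^sub>v y) \<bullet> (A *\<^sub>v y)"
      using transpose_vec_mult_scalar[OF A y Ay] sym by simp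
    finally show ?thesis .
  qed
  obtain x0 where x0: "x0 \<in> carrier_vec n" "x0 \<bullet> x0 = 1"
    and max0: "\<And>y. y \<in> carrier_vec n \<Longrightarrow> y \<bullet> (B *\<^sub>v y) \<le> x0 \<bullet> (B *\<^sub>v x0) * (y \<bullet> y)"
    using rayleigh_maximiser_exists[OF B n] by blast
  \<comment> \<open>Taking absolute values keeps the norm and, as \<open>B\<close> has non-negative
    entries, does not decrease the form; so \<open>x\<close> is a maximiser too.\<close>
  define x where "x = vec n (\<lambda>i. \<bar>x0 $ i\<bar>)"
  have x: "x \<in> carrier_vec n" and x_nonneg: "\<And>i. i < n \<Longrightarrow> 0 \<le> x $ i"
    by (auto simp: x_def)
  have norm: "x \<bullet> x = 1"
    using x0 by (simp add: x_def scalar_prod_def)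
  have "x0 \<bullet> (B *\<^sub>v x0) \<le> x \<bullet> (B *\<^sub>v x)"
    unfolding quadratic_form_sum[OF B x0(1)] quadratic_form_sum[OF B x]
  proof (intro sum_mono)
    fix i j assume "i \<in> {..<n}" "j \<in> {..<n}"
    then show "x0 $ i * (B $$ (i, j) * x0 $ j) \<le> x $ i * (B $$ (i, j) * x $ j)"
      using B_nonneg[of i j] abs_ge_self[of "x0 $ i * (B $$ (i, j) * x0 $ j)"]
      by (simp add: x_def abs_mult)
  qed
  moreover define m where "m = x \<bullet> (B *\<^sub>v x)"
  ultimately have m: "x0 \<bullet> (B *\<^sub>v x0) = m"
    using max0[OF x] norm by simp
  then have max: "y \<bullet> (B *\<^sub>v y) \<le> m * (y \<bullet> y)" if "y \<in> carrier_vec n" for y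
    using max0 that by simp
  have Bx: "B *\<^sub>v x = m \<cdot>\<^sub>v x"
    by (rule rayleigh_maximiser_eigen[OF B B_sym x max]) (simp_all add: m_def norm)
  have AAx: "A *\<^sub>v (A *\<^sub>v x) = m \<cdot>\<^sub>v x"
    using Bx A x by (simp add: B_def)
  have Ax: "A *\<^sub>v x \<in> carrier_vec n"
    using A x by simp
  have m_eq: "m = (A *\<^sub>v x) \<bullet> (A *\<^sub>v x)"
    using form[OF x] by (simp add: m_def)
  have "0 \<le> m"
    unfolding m_eq by (simp add: scalar_prod_def sum_nonneg)
  define \<mu> where "\<mu> = sqrt m"
  have \<mu>: "0 \<le> \<mu>" "\<mu> * \<mu> = m"
    using \<open>0 \<le> m\<close> by (auto simp: \<mu>_def)
  have x_neq: "x \<noteq> 0\<^sub>v n"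
    using norm by auto
  have "eigenvalue A \<mu>"
  proof (cases "\<mu> = 0")
    case True
    \<comment> \<open>The squared norm of \<open>A *\<^sub>v x\<close> is \<open>m = 0\<close>, so
      \<open>x\<close> itself is an eigenvector for 0.\<close>
    then have "A *\<^sub>v x = 0\<^sub>v n"
      using scalar_prod_self_eq_0_iff[OF Ax] m_eq \<mu> by simp
    then have "eigenvector A x \<mu>"
      using A x x_neq True by (auto simp: eigenvector_def)
    then show ?thesis
      by (auto simp: eigenvalue_def)
  next
    case False
    define y where "y = A *\<^sub>v x + \<mu> \<cdot>\<^sub>v x"
    have y: "y \<in> carrier_vec n"
      using Ax x by (simp add: y_def)
    have "A *\<^sub>v y = m \<cdot>\<^sub>v x + \<mu> \<cdot>\<^sub>v (A *\<^sub>v x)"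
      using A x Ax AAx by (simp add: y_def mult_add_distrib_mat_vec[of _ n n] mult_mat_vec[of _ n n])
    also have "\<dots> = \<mu> \<cdot>\<^sub>v y"
      using A x by (intro eq_vecI) (auto simp: y_def algebra_simps simp flip: \<mu>(2))
    finally have "A *\<^sub>v y = \<mu> \<cdot>\<^sub>v y" .
    moreover have "y \<noteq> 0\<^sub>v n"
    proof
      assume y0: "y = 0\<^sub>v n"
      \<comment> \<open>The non-negative numbers \<open>(A *\<^sub>v x) $ i\<close> and
        \<open>\<mu> * x $ i\<close> add up to 0, and \<mu> is positive.\<close>
      have "x $ i = 0" if i: "i < n" for i
      proof -
        have "0 \<le> (A *\<^sub>v x) $ i"
          using A x i nonneg x_nonneg by (auto simp: scalar_prod_def intro!: sum_nonneg)
        moreover have "(A *\<^sub>v x) $ i + \<mu> * x $ i = 0"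
          using arg_cong[OF y0, of "\<lambda>v. v $ i"] A x i by (simp add: y_def)
        ultimately show ?thesis
          using \<mu> False x_nonneg[OF i] by (smt (verit) mult_nonneg_nonneg mult_eq_0_iff)
      qed
      then show False
        using x_neq x by (auto intro!: eq_vecI)
    qed
    ultimately have "eigenvector A y \<mu>"
      using A y by (auto simp: eigenvector_def)
    then show ?thesis
      by (auto simp: eigenvalue_def)
  qed
  moreover have "(A *\<^sub>v y) \<bullet> (A *\<^sub>v y) \<le> \<mu>\<^sup>2 * (y \<bullet> y)" if "y \<in> carrier_vec n" for y
    using max[OF that] form[OF that] \<mu> by (simp add: power2_eq_square)
  ultimately show ?thesis
    using that \<mu> by blast
qed

text \<open>The matrix maps the all-ones vector \<open>e\<close>, of squared norm \<open>N\<close>,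
  to the vector of degrees. The norm bound at \<open>e\<close> therefore compares the mean squared
  degree with the square of an eigenvalue.\<close>

lemma quadratic_mean_degree_le_lambda1:
  assumes adj: "weighted_adjacency N A" and N: "0 < N"
  shows "sqrt ((\<Sum>i<N. (wdegree A i)\<^sup>2) / N) \<le> lambda1 A"
proof -
  have A: "A \<in> carrier_mat N N" and sym: "transpose_mat A = A"
    and nonneg: "\<And>i j. i < N \<Longrightarrow> j < N \<Longrightarrow> 0 \<le> A $$ (i, j)"
    using adj by (simp_all add: weighted_adjacency_def)
  obtain \<mu> where \<mu>: "eigenvalue A \<mu>" "0 \<le> \<mu>"
    and max: "\<forall>y\<in>carrier_vec N. (A *\<^sub>v y) \<bullet> (A *\<^sub>v y) \<le> \<mu>\<^sup>2 * (y \<bullet> y)"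
    using nonneg_symmetric_top_eigenvalue[OF A sym N nonneg] by blast
  define e :: "real vec" where "e = vec N (\<lambda>_. 1)"
  have "A *\<^sub>v e = vec N (wdegree A)"
    using A by (intro eq_vecI) (auto simp: e_def wdegree_def scalar_prod_def lessThan_atLeast0)
  then have "(A *\<^sub>v e) \<bullet> (A *\<^sub>v e) = (\<Sum>i<N. (wdegree A i)\<^sup>2)"
    by (simp add: scalar_prod_def power2_eq_square lessThan_atLeast0)
  moreover have "e \<bullet> e = N"
    by (simp add: e_def scalar_prod_def)
  ultimately have "(\<Sum>i<N. (wdegree A i)\<^sup>2) / N \<le> \<mu>\<^sup>2"
    using bspec[OF max, of e] N by (simp add: e_def divide_le_eq)
  then have "sqrt ((\<Sum>i<N. (wdegree A i)\<^sup>2) / N) \<le> \<mu>"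
    using \<mu> by (simp add: real_le_lsqrt)
  also have "\<mu> \<le> lambda1 A"
    unfolding lambda1_def using card_finite_spectrum(1)[OF A] \<mu>(1)
    by (intro Max_ge) (auto simp: spectrum_def)
  finally show ?thesis .
qed

section \<open>The two bounds on the spectral degree exponent\<close>

theorem theorem4:
  fixes N :: nat and A :: "real mat" and q :: ereal
    and c :: nat and dmax d2 lam :: real
  assumes "weighted_adjacency N A"
    and "\<not> regular A"
    and "is_sde A q"
    and "dmax = max_degree A"
    and "c = max_degree_mult A"
    and "d2 = second_degree A"
    and "lam = lambda1 A"
  shows "ereal (ln (real N) - ln (real c + (real N - real c) * (d2 / dmax) ^ 2))
           / ereal (ln (dmax / lam)) \<le> q
       \<and> q \<le> ereal (ln (real N / real c)) / ereal (ln (dmax / lam))"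
proof -
  note adj = assms(1)
  have A: "A \<in> carrier_mat N N"
    using adj by (simp add: weighted_adjacency_def)
  then have dim: "dim_row A = N" "dim_col A = N"
    by auto
  define d where "d = wdegree A"
  have d_nonneg: "0 \<le> d i" if "i < N" for i
    using that adj dim by (auto simp: d_def wdegree_def weighted_adjacency_def intro!: sum_nonneg)
  obtain j k where jk: "j < N" "k < N" "d j \<noteq> d k"
    using assms(2) unfolding regular_def d_def dim by blast
  then have N: "0 < N"
    by simp
  have degs: "degree_values A = d ` {..<N}"
    by (simp add: degree_values_def d_def dim)
  have fin: "finite (degree_values A)"
    by (simp add: degs)
  have d_le: "d i \<le> dmax" if "i < N" for i
    unfolding assms(4) max_degree_def using fin that by (intro Max_ge) (auto simp: degs)
  have "dmax \<in> degree_values A"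
    unfolding assms(4) max_degree_def using fin N by (intro Max_in) (auto simp: degs)
  then obtain top where top: "top < N" "d top = dmax"
    by (auto simp: degs)
  \<comment> \<open>Of two different degrees at least one is below the maximum. This node yields
    \<open>0 < dmax\<close>, \<open>c < N\<close> and \<open>0 \<le> d2\<close>, and later
    \<open>s < N\<close>.\<close>
  obtain low where low: "low < N" "d low < dmax"
  proof (cases "d j < dmax")
    case False
    then have "d k < dmax"
      using jk d_le[OF jk(1)] d_le[OF jk(2)] by linarith
    then show ?thesis
      using jk that by blast
  qed (use jk that in blast)
  have dmax: "0 < dmax"
    using low d_nonneg[OF low(1)] by linarith
  define P where "P = {i. i < N \<and> d i = dmax}"
  have P: "P \<subseteq> {..<N}" "finite P" "card P = c" "top \<in> P" "low \<notin> P"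
    using top low by (auto simp: P_def assms(4,5) max_degree_mult_def d_def dim)
  have c: "0 < c" "c < N"
  proof -
    show "0 < c"
      using P card_gt_0_iff by blast
    have "P \<subset> {..<N}"
      using P low by blast
    then show "c < N"
      using psubset_card_mono[of "{..<N}" P] P by simp
  qed
  have d_le2: "d i \<le> d2" if "i < N" "d i < dmax" for i
    unfolding assms(6) second_degree_def using fin that
    by (intro Max_ge) (auto simp: degs assms(4))
  have d2_nonneg: "0 \<le> d2"
    using d_nonneg[OF low(1)] d_le2[OF low] by linarith
  \<comment> \<open>No admissible exponent below 2, negative ones included, can solve the defining
    equation: its power mean stays strictly below the quadratic mean.\<close>
  have mean_less: "((\<Sum>i<N. d i powr r) / N) powr (1 / r) < lam"
    if "r \<noteq> 0" "r < 2" "r < 0 \<Longrightarrow> (\<And>i. i < N \<Longrightarrow> 0 < d i)" for r :: real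
  proof -
    have "((\<Sum>i<N. d i powr r) / N) powr (1 / r) < ((\<Sum>i<N. d i powr 2) / N) powr (1 / 2)"
      using power_mean_strict_mono[of "{..<N}" d j k r 2] that jk d_nonneg by simp
    also have "(\<Sum>i<N. d i powr 2) = (\<Sum>i<N. (d i)\<^sup>2)"
      using d_nonneg by (intro sum.cong) auto
    also have "((\<Sum>i<N. (d i)\<^sup>2) / N) powr (1 / 2) \<le> lam"
      using quadratic_mean_degree_le_lambda1[OF adj N]
      by (simp add: powr_half_sqrt sum_nonneg d_def assms(7))
    finally show ?thesis .
  qed
  show ?thesis
  proof (cases q)
    case MInf
    then show ?thesis
      using assms(3) by (simp add: is_sde_def)
  next
    case PInf
    then have "lam = dmax"
      using assms by (simp add: is_sde_def)
    \<comment> \<open>The denominator is \<open>ln 1 = 0\<close> and \<open>N / c > 1\<close>, so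
      the upper bound is infinite; the lower bound is trivial.\<close>
    then show ?thesis
      using PInf c dmax by (simp add: ereal_pos_divide_zero)
  next
    case (real r)
    have lam: "lam = ((\<Sum>i<N. d i powr r) / N) powr (1 / r)" and r: "r \<noteq> 0"
      and r_neg: "r < 0 \<Longrightarrow> (\<And>i. i < N \<Longrightarrow> 0 < d i)"
      using assms(3) real by (auto simp: is_sde_def dim d_def assms(7))
    have r2: "2 \<le> r"
      using mean_less[OF r _ r_neg] lam by force
    \<comment> \<open>Scaling by \<open>dmax\<close> turns the defining equation into
      \<open>lam / dmax = (s / N) powr (1 / r)\<close>, so both bounds become estimates of
      \<open>s\<close>.\<close>
    define s where "s = (\<Sum>i<N. (d i / dmax) powr r)"
    have split: "s = c + (\<Sum>i\<in>{..<N} - P. (d i / dmax) powr r)"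
    proof -
      have "s = (\<Sum>i\<in>{..<N} - P. (d i / dmax) powr r) + (\<Sum>i\<in>P. (d i / dmax) powr r)"
        unfolding s_def using P(1) by (intro sum.subset_diff) auto
      also have "(\<Sum>i\<in>P. (d i / dmax) powr r) = (\<Sum>i\<in>P. 1)"
        using dmax by (intro sum.cong) (auto simp: P_def)
      finally show ?thesis
        using P by simp
    qed
    have s_ge: "c \<le> s"
      unfolding split by (simp add: sum_nonneg)
    have card_rest: "real (card ({..<N} - P)) = real N - real c"
      using P c by (simp add: card_Diff_subset of_nat_diff)
    have s_le: "s \<le> c + (real N - real c) * (d2 / dmax)\<^sup>2"
    proof -
      have "(\<Sum>i\<in>{..<N} - P. (d i / dmax) powr r) \<le> (\<Sum>i\<in>{..<N} - P. (d2 / dmax)\<^sup>2)"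
      proof (rule sum_mono)
        fix i assume "i \<in> {..<N} - P"
        then have i: "i < N" "d i < dmax"
          using d_le[of i] by (auto simp: P_def)
        \<comment> \<open>The base lies between 0 and 1, so lowering the exponent from
          \<open>r\<close> to 2 can only increase the power.\<close>
        have "(d i / dmax) powr r \<le> (d i / dmax) powr 2"
          using i dmax d_nonneg[of i] r2 by (intro powr_mono') auto
        also have "\<dots> = (d i / dmax)\<^sup>2"
          using i dmax d_nonneg[of i] by simp
        also have "\<dots> \<le> (d2 / dmax)\<^sup>2"
          using i dmax d_nonneg[of i] d_le2[of i] by (intro power_mono divide_right_mono) auto
        finally show "(d i / dmax) powr r \<le> (d2 / dmax)\<^sup>2" .
      qed
      then show ?thesis
        using card_rest by (simp add: split)
    qed
    have s_less: "s < N"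
    proof -
      have "s < (\<Sum>i<N. 1)"
        unfolding s_def
      proof (rule sum_strict_mono_ex1)
        show "\<forall>i\<in>{..<N}. (d i / dmax) powr r \<le> 1"
          using d_nonneg d_le dmax r2 by (auto intro!: powr_le1)
        have "(d low / dmax) powr r < 1 powr r"
          using low d_nonneg[of low] dmax r2 by (intro powr_less_mono2) auto
        then show "\<exists>i\<in>{..<N}. (d i / dmax) powr r < 1"
          using low by auto
      qed simp
      then show ?thesis
        by simp
    qed
    have s_pos: "0 < s"
      using s_ge c by linarith
    have s_eq: "s = (\<Sum>i<N. d i powr r) / dmax powr r"
      using d_nonneg dmax by (simp add: s_def powr_divide sum_divide_distrib)
    have "lam = (s / N * dmax powr r) powr (1 / r)"
      using dmax by (simp add: lam s_eq)
    also have "\<dots> = (s / N) powr (1 / r) * dmax"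
      using dmax s_pos r by (subst powr_mult) (auto simp: powr_powr)
    finally have lam_eq: "lam = (s / N) powr (1 / r) * dmax" .
    then have "ln lam = ln ((s / N) powr (1 / r)) + ln dmax"
      using dmax s_pos N by (simp add: ln_mult)
    also have "ln ((s / N) powr (1 / r)) = (ln s - ln N) / r"
      using s_pos N by (simp add: ln_powr ln_div)
    finally have "ln lam = (ln s - ln N) / r + ln dmax" .
    moreover have "0 < lam"
      unfolding lam_eq using dmax s_pos N by simp
    ultimately have ln_eq: "ln (dmax / lam) = (ln N - ln s) / r"
      using dmax by (simp add: ln_div diff_divide_distrib)
    \<comment> \<open>Strictness of \<open>s < N\<close> makes the common denominator positive, so
      that both quotients can be cleared.\<close>
    have L: "0 < ln (dmax / lam)"
      unfolding ln_eq using s_pos s_less r2 by simp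
    have r_eq: "r * ln (dmax / lam) = ln N - ln s"
      using r by (simp add: ln_eq)
    have lower: "ln N - ln (c + (real N - real c) * (d2 / dmax)\<^sup>2) \<le> r * ln (dmax / lam)"
      unfolding r_eq using s_pos s_le by simp
    have upper: "r * ln (dmax / lam) \<le> ln (N / c)"
    proof -
      have "ln (real c) \<le> ln s"
        using s_ge c by simp
      then show ?thesis
        unfolding r_eq using c N by (subst ln_div) auto
    qed
    have "ereal u / ereal w \<le> ereal r \<and> ereal r \<le> ereal v / ereal w"
      if "0 < w" "u \<le> r * w" "r * w \<le> v" for u v w
      using that by (simp add: pos_divide_le_eq pos_le_divide_eq)
    from this[OF L lower upper] show ?thesis
      unfolding real .
  qed
qed

end
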